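(* The set function $d_\infty$ satisfies the following properties. (i) If $Y$ is a metric space and $X\subset Y$ (with the induced metric), then $d_\infty(X)\leq d_\infty(Y)$. (ii) If $X$ is a metric space and $X_1,X_2\subset X$ (with $X_1$, $X_2$, $X_1\cup X_2$ endowed with the induced metrics), then $d_\infty(X_1\cup X_2)=\max\{d_\infty(X_1),d_\infty(X_2)\}$. (iii) If $X$ and $Y$ are metric spaces, then $d_\infty(X\times Y)\leq d_\infty(X)+d_\infty(Y)$.
   Context: For a metric space $(X,\delta)$, $B_X(x,R)$ denotes the open ball with centre $x\in X$ and radius $R$, and for $\Omega\subset X$, $n_r(\Omega)$ denotes the least number (possibly $+\infty$) of open balls of $X$ of radius $r$ which cover $\Omega$. The asymptotic dimension of $X$ is $$d_\infty(X):=\lim_{r\to\infty}\limsup_{R\to\infty}\frac{\log n_r(B_X(x,R))}{\log R}\in[0,\infty],$$ where $x\in X$ is any point (spaces are nonempty; the value does not depend on the choice of $x$, and the limit in $r$ exists by monotonicity). In (iii), $X\times Y$ carries the product metric $\big(\delta_X(x_1,x_2)^2+\delta_Y(y_1,y_2)^2\big)^{1/2}$, or any metric roughly isometric to it, e.g. $\delta_{X\times Y}((x_1,y_1),(x_2,y_2))=\max\{\delta_X(x_1,x_2),\delta_Y(y_1,y_2)\}$. Here a map $f:X\to Y$ of metric spaces is a rough isometry if there are $a\ge1$, $b,\varepsilon\ge0$ with $a^{-1}\delta_X(x_1,x_2)-b\leq \delta_Y(f(x_1),f(x_2))\leq a\,\delta_X(x_1,x_2)+b$ for all $x_1,x_2\in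 X$ and $\bigcup_{x\in X}B_Y(f(x),\varepsilon)=Y$. *)

theory Defs
  imports "HOL-Analysis.Analysis"
begin

text \<open>
  Metric spaces are elements of the library type \<open>'a metric\<close> (carrier \<open>mspace m\<close>, distance
  \<open>mdist m\<close>), so that induced metrics (\<open>submetric\<close>) and products (\<open>prod_metric\<close>, whose distance
  is \<open>sqrt (d1\<^sup>2 + d2\<^sup>2)\<close>) are objects of the same kind.
\<close>

text \<open>
  The centres range over the space itself, so the covering number of a subset depends on the
  ambient space. If there is no finite cover, the infimum is taken over the empty set of extended
  naturals and equals \<open>\<infinity>\<close>.
\<close>

definition covering_number :: "'a metric \<Rightarrow> real \<Rightarrow> 'a set \<Rightarrow> enat" where
  "covering_number m r \<Omega> =
     Inf {enat (card \<B>) | \<B>. finite \<B> \<and> \<B> \<subseteq> (\<lambda>c. mball_of m c r) ` mspace m \<and> \<Omega> \<subseteq> \<Union>\<B>}"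

definition ln_enat :: "enat \<Rightarrow> ereal" where
  "ln_enat n = (case n of enat k \<Rightarrow> if k = 0 then - \<infinity> else ereal (ln (real k)) | \<infinity> \<Rightarrow> \<infinity>)"

definition asymp_dim_at :: "'a metric \<Rightarrow> 'a \<Rightarrow> ereal" where
  "asymp_dim_at m x =
     Lim at_top (\<lambda>r::real. Limsup at_top (\<lambda>R::real.
       ln_enat (covering_number m r (mball_of m x R)) / ereal (ln R)))"

text \<open>
  On a nonempty space \<open>asymp_dim_at m x\<close> is the same for all \<open>x \<in> mspace m\<close>, so the choice of the
  base point is immaterial; on the empty space \<open>asymp_dim m\<close> is meaningless.
\<close>

definition asymp_dim :: "'a metric \<Rightarrow> ereal" where
  "asymp_dim m = asymp_dim_at m (SOME x. x \<in> mspace m)"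

definition rough_isometry :: "'a metric \<Rightarrow> 'b metric \<Rightarrow> ('a \<Rightarrow> 'b) \<Rightarrow> bool" where
  "rough_isometry m1 m2 f \<longleftrightarrow>
     f ` mspace m1 \<subseteq> mspace m2 \<and>
     (\<exists>a b \<epsilon> :: real. a \<ge> 1 \<and> b \<ge> 0 \<and> \<epsilon> \<ge> 0 \<and>
        (\<forall>x\<in>mspace m1. \<forall>y\<in>mspace m1.
           inverse a * mdist m1 x y - b \<le> mdist m2 (f x) (f y) \<and>
           mdist m2 (f x) (f y) \<le> a * mdist m1 x y + b) \<and>
        (\<Union>x\<in>mspace m1. mball_of m2 (f x) \<epsilon>) = mspace m2)"

definition roughly_isometric :: "'a metric \<Rightarrow> 'b metric \<Rightarrow> bool" where
  "roughly_isometric m1 m2 \<longleftrightarrow> (\<exists>f. rough_isometry m1 m2 f)"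

end

theory Submission
  imports Defs
begin

text \<open>
  For a real number \<open>s\<close>, say that a space has growth of order \<open>s\<close> if, for some fixed \<open>D\<close>, its balls
  of large radius \<open>R\<close> are covered by \<open>O(R powr s)\<close> sets of diameter at most \<open>D\<close>. The asymptotic
  dimension is the infimum of the \<open>s\<close> for which this holds
  (\<open>growth_if_asymp_dim_less\<close> and \<open>asymp_dim_le_if_growth\<close>). Up to a change of scale, covering by
  balls of a fixed radius and by sets of a fixed diameter are the same thing; but diameters, unlike
  balls, do not see where the centres lie, so that a subset and its ambient space can be compared
  directly.

  In these terms all claims are statements about covers. A cover of the target of a quasi-isometric
  embedding pulls back to a cover of the source (\<open>growth_pullback\<close>): this gives monotonicity,
  independence of the base point, and, since a rough isometry has a quasi-inverse
  (\<open>rough_isometry_quasi_inverse\<close>), the passage from the product metric to any metric roughly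
  isometric to it. The union of covers of two subspaces has at most \<open>O(R powr s) + O(R powr s)\<close>
  members, which is again \<open>O(R powr s)\<close>; the products of the members of two covers form a cover of
  the product space with at most \<open>O(R powr s) * O(R powr t) = O(R powr (s + t))\<close> members.
\<close>

section \<open>Covers by sets of bounded diameter\<close>

definition small_cover :: "'a metric \<Rightarrow> real \<Rightarrow> real \<Rightarrow> 'a set \<Rightarrow> bool" where
  "small_cover m D n A \<longleftrightarrow>
     (\<exists>\<U>. finite \<U> \<and> real (card \<U>) \<le> n \<and> A \<subseteq> \<Union>\<U> \<and> (\<forall>U\<in>\<U>. \<forall>p\<in>U. \<forall>q\<in>U. mdist m p q \<le> D))"

lemma small_cover_mono:
  assumes "small_cover m D n A" "D \<le> D'" "n \<le> n'" "A' \<subseteq> A"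
  shows "small_cover m D' n' A'"
proof -
  obtain \<U> where "finite \<U>" "real (card \<U>) \<le> n" "A \<subseteq> \<Union>\<U>"
      "\<forall>U\<in>\<U>. \<forall>p\<in>U. \<forall>q\<in>U. mdist m p q \<le> D"
    using assms(1) unfolding small_cover_def by blast
  then show ?thesis
    unfolding small_cover_def using assms(2-4) by (intro exI[of _ \<U>]) fastforce
qed

lemma small_cover_Un:
  assumes "small_cover m D1 n1 A1" "small_cover m D2 n2 A2"
  shows "small_cover m (max D1 D2) (n1 + n2) (A1 \<union> A2)"
proof -
  obtain \<U> where U: "finite \<U>" "real (card \<U>) \<le> n1" "A1 \<subseteq> \<Union>\<U>"
      "\<forall>U\<in>\<U>. \<forall>p\<in>U. \<forall>q\<in>U. mdist m p q \<le> D1"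
    using assms(1) unfolding small_cover_def by blast
  obtain \<V> where V: "finite \<V>" "real (card \<V>) \<le> n2" "A2 \<subseteq> \<Union>\<V>"
      "\<forall>U\<in>\<V>. \<forall>p\<in>U. \<forall>q\<in>U. mdist m p q \<le> D2"
    using assms(2) unfolding small_cover_def by blast
  have "card (\<U> \<union> \<V>) \<le> card \<U> + card \<V>"
    by (rule card_Un_le)
  then have "real (card (\<U> \<union> \<V>)) \<le> n1 + n2"
    using U(2) V(2) by linarith
  moreover have "\<forall>W\<in>\<U> \<union> \<V>. \<forall>p\<in>W. \<forall>q\<in>W. mdist m p q \<le> max D1 D2"
    using U(4) V(4) by (auto simp: le_max_iff_disj)
  moreover have "A1 \<union> A2 \<subseteq> \<Union>(\<U> \<union> \<V>)"
    using U(3) V(3) by auto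
  ultimately show ?thesis
    unfolding small_cover_def using U(1) V(1) by (meson finite_UnI)
qed

lemma small_cover_prod:
  assumes "small_cover m1 D1 n1 A1" "small_cover m2 D2 n2 A2"
    and "A1 \<subseteq> mspace m1" "A2 \<subseteq> mspace m2"
  shows "small_cover (prod_metric m1 m2) (D1 + D2) (n1 * n2) (A1 \<times> A2)"
proof -
  obtain \<U> where U: "finite \<U>" "real (card \<U>) \<le> n1" "A1 \<subseteq> \<Union>\<U>"
      "\<forall>U\<in>\<U>. \<forall>p\<in>U. \<forall>q\<in>U. mdist m1 p q \<le> D1"
    using assms(1) unfolding small_cover_def by blast
  obtain \<V> where V: "finite \<V>" "real (card \<V>) \<le> n2" "A2 \<subseteq> \<Union>\<V>"
      "\<forall>U\<in>\<V>. \<forall>p\<in>U. \<forall>q\<in>U. mdist m2 p q \<le> D2"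
    using assms(2) unfolding small_cover_def by blast
  define \<W> where "\<W> = (\<lambda>(U, V). U \<times> V) ` (\<U> \<times> \<V>)"
  have "card \<W> \<le> card \<U> * card \<V>"
    unfolding \<W>_def using card_image_le[of "\<U> \<times> \<V>"] U(1) V(1)
    by (simp add: card_cartesian_product)
  then have "real (card \<W>) \<le> real (card \<U>) * real (card \<V>)"
    by (metis of_nat_le_iff of_nat_mult)
  also have "\<dots> \<le> n1 * n2"
    using U(2) V(2) by (intro mult_mono) auto
  finally have "real (card \<W>) \<le> n1 * n2" .
  moreover have "finite \<W>"
    unfolding \<W>_def using U(1) V(1) by simp
  moreover have "A1 \<times> A2 \<subseteq> \<Union>\<W>"
    unfolding \<W>_def using U(3) V(3) by fastforce
  moreover have "\<forall>W\<in>\<W>. \<forall>p\<in>W. \<forall>q\<in>W. mdist (prod_metric m1 m2) p q \<le> D1 + D2"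
  proof (intro ballI)
    fix W p q assume "W \<in> \<W>" "p \<in> W" "q \<in> W"
    then obtain U V where "U \<in> \<U>" "V \<in> \<V>" "p \<in> U \<times> V" "q \<in> U \<times> V"
      unfolding \<W>_def by auto
    then have "mdist m1 (fst p) (fst q) \<le> D1" "mdist m2 (snd p) (snd q) \<le> D2"
      using U(4) V(4) by auto
    moreover have "mdist (prod_metric m1 m2) p q
        \<le> mdist m1 (fst p) (fst q) + mdist m2 (snd p) (snd q)"
      by (simp add: prod_dist_def case_prod_unfold sqrt_sum_squares_le_sum)
    ultimately show "mdist (prod_metric m1 m2) p q \<le> D1 + D2"
      by linarith
  qed
  ultimately show ?thesis
    unfolding small_cover_def by blast
qed

text \<open>The preimages of the members of a cover of \<open>B\<close> cover \<open>A\<close>, and they are small because points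
  with nearby images are themselves near each other.\<close>

lemma small_cover_vimage:
  assumes "small_cover m2 D n B"
    and "a \<ge> 0"
    and "\<And>p q. \<lbrakk>p \<in> mspace m1; q \<in> mspace m1\<rbrakk> \<Longrightarrow> mdist m1 p q \<le> a * mdist m2 (f p) (f q) + b"
    and "A \<subseteq> mspace m1" "f ` A \<subseteq> B"
  shows "small_cover m1 (a * D + b) n A"
proof -
  obtain \<U> where U: "finite \<U>" "real (card \<U>) \<le> n" "B \<subseteq> \<Union>\<U>"
      "\<forall>U\<in>\<U>. \<forall>p\<in>U. \<forall>q\<in>U. mdist m2 p q \<le> D"
    using assms(1) unfolding small_cover_def by blast
  define \<V> where "\<V> = (\<lambda>U. f -` U \<inter> mspace m1) ` \<U>"
  have "real (card \<V>) \<le> n"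
    unfolding \<V>_def using card_image_le[OF U(1)] U(2) by (meson of_nat_le_iff order_trans)
  moreover have "A \<subseteq> \<Union>\<V>"
    unfolding \<V>_def using U(3) assms(4,5) by fastforce
  moreover have "\<forall>V\<in>\<V>. \<forall>p\<in>V. \<forall>q\<in>V. mdist m1 p q \<le> a * D + b"
  proof (intro ballI)
    fix V p q assume "V \<in> \<V>" "p \<in> V" "q \<in> V"
    then obtain U where U': "U \<in> \<U>" "f p \<in> U" "f q \<in> U" "p \<in> mspace m1" "q \<in> mspace m1"
      unfolding \<V>_def by auto
    then have "mdist m1 p q \<le> a * mdist m2 (f p) (f q) + b"
      using assms(3) by blast
    also have "\<dots> \<le> a * D + b"
      using U' U(4) assms(2) by (simp add: mult_left_mono)
    finally show "mdist m1 p q \<le> a * D + b" .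
  qed
  moreover have "finite \<V>"
    unfolding \<V>_def using U(1) by simp
  ultimately show ?thesis
    unfolding small_cover_def by blast
qed

lemma small_cover_of_covering_number:
  assumes "covering_number m r A = enat k"
  shows "small_cover m (2 * r) (real k) A"
proof -
  let ?S = "{enat (card \<B>) | \<B>. finite \<B> \<and> \<B> \<subseteq> (\<lambda>c. mball_of m c r) ` mspace m \<and> A \<subseteq> \<Union>\<B>}"
  have eq: "Inf ?S = enat k"
    using assms unfolding covering_number_def .
  \<comment> \<open>A finite infimum of extended naturals is attained.\<close>
  then have "?S \<noteq> {}"
    by (metis Inf_enat_def enat.distinct(1))
  then have "Inf ?S \<in> ?S"
    unfolding Inf_enat_def by (metis (no_types, lifting) LeastI ex_in_conv)
  then have "enat k \<in> ?S"
    unfolding eq .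
  then obtain \<B> where B: "finite \<B>" "card \<B> = k"
      "\<B> \<subseteq> (\<lambda>c. mball_of m c r) ` mspace m" "A \<subseteq> \<Union>\<B>"
    by auto
  have "\<forall>U\<in>\<B>. \<forall>p\<in>U. \<forall>q\<in>U. mdist m p q \<le> 2 * r"
  proof (intro ballI)
    fix U p q assume "U \<in> \<B>" "p \<in> U" "q \<in> U"
    then obtain c where "c \<in> mspace m" "p \<in> mspace m" "q \<in> mspace m"
        "mdist m c p < r" "mdist m c q < r"
      using B(3) by auto
    then show "mdist m p q \<le> 2 * r"
      using mdist_triangle[of p m c q] by (simp add: mdist_commute)
  qed
  then show ?thesis
    unfolding small_cover_def using B by blast
qed

text \<open>A set of diameter at most \<open>D\<close> lies in the open ball of radius \<open>D + 1\<close> about any of its points;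
  the increment is there because the ball is open.\<close>

lemma covering_number_le_of_small_cover:
  assumes "small_cover m D n A" "A \<subseteq> mspace m"
  obtains k where "covering_number m (D + 1) A \<le> enat k" "real k \<le> n"
proof -
  obtain \<U> where U: "finite \<U>" "real (card \<U>) \<le> n" "A \<subseteq> \<Union>\<U>"
      "\<forall>U\<in>\<U>. \<forall>p\<in>U. \<forall>q\<in>U. mdist m p q \<le> D"
    using assms(1) unfolding small_cover_def by blast
  \<comment> \<open>Members of the cover that miss the space offer no centre.\<close>
  define \<V> where "\<V> = {U \<in> \<U>. U \<inter> mspace m \<noteq> {}}"
  define c where "c U = (SOME x. x \<in> U \<inter> mspace m)" for U
  have c: "c U \<in> U \<inter> mspace m" if "U \<in> \<V>" for U
    using that unfolding \<V>_def c_def by (simp add: some_in_eq del: Int_iff)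
  define \<B> where "\<B> = (\<lambda>U. mball_of m (c U) (D + 1)) ` \<V>"
  have fin: "finite \<V>"
    unfolding \<V>_def using U(1) by simp
  have "A \<subseteq> \<Union>\<B>"
  proof
    fix p assume p: "p \<in> A"
    then obtain V where V: "V \<in> \<U>" "p \<in> V"
      using U(3) by blast
    then have VV: "V \<in> \<V>"
      unfolding \<V>_def using p assms(2) by blast
    then have "mdist m (c V) p \<le> D"
      using U(4) V c by blast
    then have "p \<in> mball_of m (c V) (D + 1)"
      using c[OF VV] p assms(2) by auto
    then show "p \<in> \<Union>\<B>"
      unfolding \<B>_def using VV by blast
  qed
  moreover have "\<B> \<subseteq> (\<lambda>c. mball_of m c (D + 1)) ` mspace m"
    unfolding \<B>_def using c by blast
  moreover have "finite \<B>"
    unfolding \<B>_def using fin by simp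
  ultimately have "covering_number m (D + 1) A \<le> enat (card \<B>)"
    unfolding covering_number_def by (intro Inf_lower) blast
  moreover have "card \<B> \<le> card \<U>"
    unfolding \<B>_def using card_image_le[OF fin] card_mono[OF U(1), of \<V>]
    by (metis (no_types, lifting) \<V>_def mem_Collect_eq order_trans subsetI)
  ultimately show ?thesis
    using that[of "card \<B>"] U(2) by simp
qed

section \<open>Growth of order s\<close>

definition growth_at :: "'a metric \<Rightarrow> 'a \<Rightarrow> real \<Rightarrow> bool" where
  "growth_at m x s \<longleftrightarrow>
     (\<exists>D C. eventually (\<lambda>R. small_cover m D (C * R powr s) (mball_of m x R)) at_top)"

lemma growth_atD_scaled:
  assumes "growth_at m x s" and "k > 0"
  obtains D C where
    "eventually (\<lambda>R. small_cover m D (C * R powr s) (mball_of m x (k * R))) at_top"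
proof -
  obtain D C where "eventually (\<lambda>R. small_cover m D (C * R powr s) (mball_of m x R)) at_top"
    using assms(1) unfolding growth_at_def by blast
  then obtain N where N: "\<And>R. R \<ge> N \<Longrightarrow> small_cover m D (C * R powr s) (mball_of m x R)"
    unfolding eventually_at_top_linorder by blast
  have "small_cover m D ((C * k powr s) * R powr s) (mball_of m x (k * R))"
    if "R \<ge> max 0 (N / k)" for R
    using N[of "k * R"] that assms(2)
    by (simp add: powr_mult pos_divide_le_eq mult.commute mult.left_commute)
  then show ?thesis
    using that unfolding eventually_at_top_linorder by blast
qed

text \<open>The exponent \<open>s\<close> may be negative, so the bound is not monotone in the radius; linear rescaling,
  unlike translation, changes it exactly by the constant factor \<open>k powr s\<close>. An additive error in the
  radius is therefore absorbed into a factor.\<close>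

lemma growth_atD_affine:
  assumes "growth_at m x s" and "a \<ge> 0"
  obtains D C where
    "eventually (\<lambda>R. small_cover m D (C * R powr s) (mball_of m x (a * R + b))) at_top"
proof -
  obtain D C where
    ev: "eventually (\<lambda>R. small_cover m D (C * R powr s) (mball_of m x ((a + 1) * R))) at_top"
    using growth_atD_scaled[OF assms(1), of "a + 1"] assms(2) by auto
  have "eventually (\<lambda>R. small_cover m D (C * R powr s) (mball_of m x (a * R + b))) at_top"
    using ev eventually_ge_at_top[of b]
  proof eventually_elim
    case (elim R)
    then show ?case
      by (auto elim!: small_cover_mono simp: algebra_simps)
  qed
  then show ?thesis
    using that by blast
qed

section \<open>Asymptotic dimension as the infimum of growth orders\<close>

lemma covering_number_antimono:
  assumes "r \<le> r'"
  shows "covering_number m r' A \<le> covering_number m r A"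
  unfolding covering_number_def
proof (rule Inf_mono)
  fix n
  assume "n \<in> {enat (card \<B>) | \<B>. finite \<B> \<and> \<B> \<subseteq> (\<lambda>c. mball_of m c r) ` mspace m \<and> A \<subseteq> \<Union>\<B>}"
  then obtain \<B> where B: "n = enat (card \<B>)" "finite \<B>"
      "\<B> \<subseteq> (\<lambda>c. mball_of m c r) ` mspace m" "A \<subseteq> \<Union>\<B>"
    by blast
  \<comment> \<open>Choosing one centre per ball keeps the number of balls from growing.\<close>
  then obtain S where S: "S \<subseteq> mspace m" "finite S" "inj_on (\<lambda>c. mball_of m c r) S"
      "\<B> = (\<lambda>c. mball_of m c r) ` S"
    by (metis finite_image_iff subset_image_inj)
  define \<B>' where "\<B>' = (\<lambda>c. mball_of m c r') ` S"
  have "card \<B>' \<le> card S"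
    unfolding \<B>'_def by (rule card_image_le[OF S(2)])
  then have "enat (card \<B>') \<le> n"
    using B(1) S(3,4) by (simp add: card_image)
  moreover have "\<Union>\<B> \<subseteq> \<Union>\<B>'"
    unfolding \<B>'_def S(4) using assms by fastforce
  ultimately show "\<exists>n'\<in>{enat (card \<B>) | \<B>. finite \<B> \<and>
      \<B> \<subseteq> (\<lambda>c. mball_of m c r') ` mspace m \<and> A \<subseteq> \<Union>\<B>}. n' \<le> n"
    using B(4) S(1,2) by (intro bexI[of _ "enat (card \<B>')"] CollectI exI[of _ \<B>'])
      (auto simp: \<B>'_def)
qed

lemma ln_enat_mono:
  assumes "n \<le> n'"
  shows "ln_enat n \<le> ln_enat n'"
proof (cases n')
  case (enat k')
  then obtain k where "n = enat k" "k \<le> k'"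
    using assms by (cases n) auto
  then show ?thesis
    using enat by (simp add: ln_enat_def)
qed (simp add: ln_enat_def)

text \<open>The limit over the scale \<open>r\<close> exists because it is a limit of a decreasing function.\<close>

lemma asymp_dim_at_eq_INF:
  "asymp_dim_at m x =
     (INF r. Limsup at_top (\<lambda>R. ln_enat (covering_number m r (mball_of m x R)) / ereal (ln R)))"
    (is "_ = (INF r. ?g r)")
proof -
  have mono: "?g r' \<le> ?g r" if "r \<le> r'" for r r'
  proof (rule Limsup_mono)
    show "eventually (\<lambda>R. ln_enat (covering_number m r' (mball_of m x R)) / ereal (ln R)
        \<le> ln_enat (covering_number m r (mball_of m x R)) / ereal (ln R)) at_top"
      using eventually_gt_at_top[of 1]
    proof eventually_elim
      case (elim R)
      then show ?case
        by (intro ereal_divide_right_mono ln_enat_mono covering_number_antimono that) auto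
    qed
  qed
  have "(?g \<longlongrightarrow> (INF r. ?g r)) at_top"
  proof (rule order_tendstoI)
    fix a assume "a < (INF r. ?g r)"
    then have "a < ?g r" for r
      by (meson INF_lower UNIV_I less_le_trans)
    then show "eventually (\<lambda>r. a < ?g r) at_top"
      by simp
  next
    fix a assume "(INF r. ?g r) < a"
    then obtain r where "?g r < a"
      unfolding INF_less_iff by blast
    then show "eventually (\<lambda>r. ?g r < a) at_top"
      unfolding eventually_at_top_linorder using mono by (meson le_less_trans)
  qed
  then show ?thesis
    unfolding asymp_dim_at_def by (intro tendsto_Lim) auto
qed

lemma growth_at_if_asymp_dim_at_less:
  assumes "asymp_dim_at m x < ereal s"
  shows "growth_at m x s"
proof -
  obtain r where
    "Limsup at_top (\<lambda>R. ln_enat (covering_number m r (mball_of m x R)) / ereal (ln R)) < ereal s"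
    using assms unfolding asymp_dim_at_eq_INF INF_less_iff by blast
  then have "eventually (\<lambda>R. ln_enat (covering_number m r (mball_of m x R)) / ereal (ln R) < ereal s)
      at_top"
    by (rule Limsup_lessD)
  then have "eventually (\<lambda>R. small_cover m (2 * r) (1 * R powr s) (mball_of m x R)) at_top"
    using eventually_gt_at_top[of 1]
  proof eventually_elim
    case (elim R)
    let ?N = "covering_number m r (mball_of m x R)"
    have lnR: "ln R > 0"
      using elim(2) by simp
    have less: "ln_enat ?N < ereal (s * ln R)"
      using elim(1) lnR by (simp add: ereal_divide_less_iff)
    then obtain k where k: "?N = enat k"
      by (cases ?N) (auto simp: ln_enat_def)
    have "real k \<le> R powr s"
    proof (cases "k = 0")
      case False
      then have "ln (real k) < s * ln R"
        using less k by (simp add: ln_enat_def)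
      then have "exp (ln (real k)) < exp (s * ln R)"
        by simp
      then show ?thesis
        using False elim(2) by (simp add: powr_def)
    qed auto
    then show ?case
      using small_cover_of_covering_number[OF k] by (auto elim: small_cover_mono)
  qed
  then show ?thesis
    unfolding growth_at_def by blast
qed

lemma asymp_dim_at_le_if_growth_at:
  assumes "growth_at m x s"
  shows "asymp_dim_at m x \<le> ereal s"
proof -
  obtain D C where
    ev: "eventually (\<lambda>R. small_cover m D (C * R powr s) (mball_of m x R)) at_top"
    using assms unfolding growth_at_def by blast
  \<comment> \<open>The logarithm of the constant is taken below, so it has to be positive.\<close>
  define C' where "C' = max C 1"
  have C': "C' > 0" "C \<le> C'"
    unfolding C'_def by auto
  have "eventually (\<lambda>R. ln_enat (covering_number m (D + 1) (mball_of m x R)) / ereal (ln R)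
      \<le> ereal (ln C' / ln R + s)) at_top"
    using ev eventually_gt_at_top[of 1]
  proof eventually_elim
    case (elim R)
    let ?N = "covering_number m (D + 1) (mball_of m x R)"
    have lnR: "ln R > 0"
      using elim(2) by simp
    obtain k where k: "?N \<le> enat k" "real k \<le> C * R powr s"
      by (rule covering_number_le_of_small_cover[OF elim(1)]) auto
    have "real k \<le> C' * R powr s"
      using k(2) C'(2) by (meson mult_right_mono order_trans powr_ge_zero)
    then have "ln_enat (enat k) \<le> ereal (ln (C' * R powr s))"
      by (auto simp: ln_enat_def)
    then have "ln_enat ?N \<le> ereal (ln C' + s * ln R)"
      using ln_enat_mono[OF k(1)] C'(1) elim(2) by (simp add: ln_mult)
    then have "ln_enat ?N / ereal (ln R) \<le> ereal (ln C' + s * ln R) / ereal (ln R)"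
      using lnR by (intro ereal_divide_right_mono) auto
    also have "\<dots> = ereal (ln C' / ln R + s)"
      using lnR by (simp add: add_divide_distrib)
    finally show ?case .
  qed
  then have "Limsup at_top (\<lambda>R. ln_enat (covering_number m (D + 1) (mball_of m x R)) / ereal (ln R))
      \<le> Limsup at_top (\<lambda>R::real. ereal (ln C' / ln R + s))"
    by (rule Limsup_mono)
  also have "\<dots> = ereal s"
  proof (rule lim_imp_Limsup)
    have "((\<lambda>R. ln C' / ln R + s) \<longlongrightarrow> 0 + s) at_top"
      by (intro tendsto_add tendsto_const tendsto_divide_0[OF tendsto_const]
          filterlim_at_top_imp_at_infinity ln_at_top)
    then show "((\<lambda>R. ereal (ln C' / ln R + s)) \<longlongrightarrow> ereal s) at_top"
      by simp
  qed simp
  finally show ?thesis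
    unfolding asymp_dim_at_eq_INF by (rule INF_lower2[OF UNIV_I])
qed

section \<open>Quasi-isometric embeddings\<close>

text \<open>The lower bound on distances in the target is stated as an upper bound on those in the source:
  the two bounds then have the same shape and can share their constants, without division by \<open>a\<close>.\<close>

definition qi_embedding :: "'a metric \<Rightarrow> 'b metric \<Rightarrow> ('a \<Rightarrow> 'b) \<Rightarrow> bool" where
  "qi_embedding m1 m2 f \<longleftrightarrow>
     f ` mspace m1 \<subseteq> mspace m2 \<and>
     (\<exists>a b. a \<ge> 0 \<and> (\<forall>p\<in>mspace m1. \<forall>q\<in>mspace m1.
        mdist m1 p q \<le> a * mdist m2 (f p) (f q) + b \<and>
        mdist m2 (f p) (f q) \<le> a * mdist m1 p q + b))"

lemma qi_embedding_submetric:
  assumes "S \<subseteq> T"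
  shows "qi_embedding (submetric m S) (submetric m T) id"
proof -
  have "\<exists>a b::real. a \<ge> 0 \<and> (\<forall>p\<in>S \<inter> mspace m. \<forall>q\<in>S \<inter> mspace m. mdist m p q \<le> a * mdist m p q + b)"
    by (intro exI[of _ 1] exI[of _ 0]) auto
  then show ?thesis
    unfolding qi_embedding_def using assms by auto
qed

text \<open>The image of a ball about \<open>x\<close> lies in a ball about \<open>y\<close> whose radius is an affine function of
  the original one, and covers pull back. Taking \<open>f\<close> to be the identity shows that the base point is
  immaterial.\<close>

lemma growth_pullback:
  assumes f: "qi_embedding m1 m2 f" and g: "growth_at m2 y s"
    and x: "x \<in> mspace m1" and y: "y \<in> mspace m2"
  shows "growth_at m1 x s"
proof -
  obtain a b where f1: "f ` mspace m1 \<subseteq> mspace m2" and a: "a \<ge> 0"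
    and lower: "\<And>p q. \<lbrakk>p \<in> mspace m1; q \<in> mspace m1\<rbrakk> \<Longrightarrow> mdist m1 p q \<le> a * mdist m2 (f p) (f q) + b"
    and upper: "\<And>p q. \<lbrakk>p \<in> mspace m1; q \<in> mspace m1\<rbrakk> \<Longrightarrow> mdist m2 (f p) (f q) \<le> a * mdist m1 p q + b"
    using f unfolding qi_embedding_def by blast
  define b' where "b' = mdist m2 y (f x) + b + 1"
  obtain D C where
    ev: "eventually (\<lambda>R. small_cover m2 D (C * R powr s) (mball_of m2 y (a * R + b'))) at_top"
    using growth_atD_affine[OF g a, of b'] by blast
  have sub: "f ` mball_of m1 x R \<subseteq> mball_of m2 y (a * R + b')" for R
  proof
    fix z assume "z \<in> f ` mball_of m1 x R"
    then obtain p where p: "z = f p" "p \<in> mspace m1" "mdist m1 x p < R"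
      by auto
    have "mdist m2 y (f p) \<le> mdist m2 y (f x) + mdist m2 (f x) (f p)"
      using f1 p(2) x y by (intro mdist_triangle) auto
    also have "\<dots> \<le> mdist m2 y (f x) + (a * mdist m1 x p + b)"
      using upper[OF x p(2)] by simp
    also have "\<dots> \<le> mdist m2 y (f x) + (a * R + b)"
      using p(3) a by (simp add: mult_left_mono)
    also have "\<dots> < a * R + b'"
      unfolding b'_def by simp
    finally show "z \<in> mball_of m2 y (a * R + b')"
      using p f1 y by auto
  qed
  have "eventually (\<lambda>R. small_cover m1 (a * D + b) (C * R powr s) (mball_of m1 x R)) at_top"
    using ev
  proof eventually_elim
    case (elim R)
    show ?case
      by (rule small_cover_vimage[OF elim a lower _ sub]) auto
  qed
  then show ?thesis
    unfolding growth_at_def by blast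
qed

lemma growth_if_asymp_dim_less:
  assumes "asymp_dim m < ereal s" and x: "x \<in> mspace m"
  shows "growth_at m x s"
proof (rule growth_pullback)
  show "qi_embedding m m id"
    using qi_embedding_submetric[of "mspace m" "mspace m" m] by simp
  show "growth_at m (SOME x. x \<in> mspace m) s"
    using assms(1) unfolding asymp_dim_def by (rule growth_at_if_asymp_dim_at_less)
  show "(SOME x. x \<in> mspace m) \<in> mspace m"
    using x by (rule someI)
qed (rule x)

lemma asymp_dim_le_if_growth:
  assumes "growth_at m x s" and x: "x \<in> mspace m"
  shows "asymp_dim m \<le> ereal s"
  unfolding asymp_dim_def
proof (rule asymp_dim_at_le_if_growth_at, rule growth_pullback)
  show "qi_embedding m m id"
    using qi_embedding_submetric[of "mspace m" "mspace m" m] by simp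
  show "(SOME x. x \<in> mspace m) \<in> mspace m"
    using x by (rule someI)
qed (fact assms)+

lemma ereal_le_if_le_all_greater_reals:
  fixes A c :: ereal
  assumes "\<And>s. A < ereal s \<Longrightarrow> c \<le> ereal s"
  shows "c \<le> A"
proof (rule dense_ge)
  fix z assume "A < z"
  then obtain s where "A < ereal s" "ereal s < z"
    using ereal_dense2 by blast
  then show "c \<le> z"
    using assms by (meson less_imp_le order_trans)
qed

lemma asymp_dim_mono_qi_embedding:
  assumes f: "qi_embedding m1 m2 f" and ne: "mspace m1 \<noteq> {}"
  shows "asymp_dim m1 \<le> asymp_dim m2"
proof (rule ereal_le_if_le_all_greater_reals)
  fix s assume s: "asymp_dim m2 < ereal s"
  obtain x where x: "x \<in> mspace m1"
    using ne by blast
  then have fx: "f x \<in> mspace m2"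
    using f unfolding qi_embedding_def by blast
  have "growth_at m1 x s"
    using growth_pullback[OF f growth_if_asymp_dim_less[OF s fx] x fx] .
  then show "asymp_dim m1 \<le> ereal s"
    using x by (rule asymp_dim_le_if_growth)
qed

text \<open>Since the \<open>\<epsilon>\<close>-balls about the image of \<open>f\<close> cover the target, sending each point to a preimage
  of some nearby image point inverts \<open>f\<close> up to the error \<open>\<epsilon>\<close>.\<close>

lemma rough_isometry_quasi_inverse:
  assumes "rough_isometry m1 m2 f"
  obtains g where "qi_embedding m2 m1 g"
proof -
  obtain a b \<epsilon> where f: "f ` mspace m1 \<subseteq> mspace m2" and ab: "a \<ge> 1" "b \<ge> 0" "\<epsilon> \<ge> 0"
    and bounds: "\<forall>x\<in>mspace m1. \<forall>y\<in>mspace m1.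
      inverse a * mdist m1 x y - b \<le> mdist m2 (f x) (f y) \<and>
      mdist m2 (f x) (f y) \<le> a * mdist m1 x y + b"
    and surj: "(\<Union>x\<in>mspace m1. mball_of m2 (f x) \<epsilon>) = mspace m2"
    using assms unfolding rough_isometry_def by (elim conjE exE) (rule that)
  have lower: "inverse a * mdist m1 x y - b \<le> mdist m2 (f x) (f y)"
    and upper: "mdist m2 (f x) (f y) \<le> a * mdist m1 x y + b"
    if "x \<in> mspace m1" "y \<in> mspace m1" for x y
    using bounds that by auto
  have "\<forall>p\<in>mspace m2. \<exists>x\<in>mspace m1. mdist m2 (f x) p < \<epsilon>"
    using surj by fastforce
  then obtain g where g: "\<And>p. p \<in> mspace m2 \<Longrightarrow> g p \<in> mspace m1"
      "\<And>p. p \<in> mspace m2 \<Longrightarrow> mdist m2 (f (g p)) p < \<epsilon>"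
    by metis
  define b' where "b' = a * (2 * \<epsilon> + b)"
  have b': "2 * \<epsilon> + b \<le> b'"
    unfolding b'_def using mult_right_mono[OF ab(1), of "2 * \<epsilon> + b"] ab by simp
  have "mdist m2 p q \<le> a * mdist m1 (g p) (g q) + b' \<and>
      mdist m1 (g p) (g q) \<le> a * mdist m2 p q + b'"
    if pq: "p \<in> mspace m2" "q \<in> mspace m2" for p q
  proof
    have fg: "f (g p) \<in> mspace m2" "f (g q) \<in> mspace m2"
      using f g(1) pq by auto
    have err: "mdist m2 p q \<le> mdist m2 (f (g p)) (f (g q)) + 2 * \<epsilon>"
      "mdist m2 (f (g p)) (f (g q)) \<le> mdist m2 p q + 2 * \<epsilon>"
      using mdist_triangle[of p m2 "f (g p)" q] mdist_triangle[of "f (g p)" m2 "f (g q)" q]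
        mdist_triangle[of "f (g p)" m2 p "f (g q)"] mdist_triangle[of p m2 q "f (g q)"]
        fg pq g(2)[OF pq(1)] g(2)[OF pq(2)] mdist_commute[of m2 p "f (g p)"]
        mdist_commute[of m2 q "f (g q)"]
      by linarith+
    show "mdist m2 p q \<le> a * mdist m1 (g p) (g q) + b'"
      using err(1) upper[OF g(1)[OF pq(1)] g(1)[OF pq(2)]] b' by linarith
    have "inverse a * mdist m1 (g p) (g q) \<le> mdist m2 p q + (2 * \<epsilon> + b)"
      using err(2) lower[OF g(1)[OF pq(1)] g(1)[OF pq(2)]] by linarith
    then have "a * (inverse a * mdist m1 (g p) (g q)) \<le> a * (mdist m2 p q + (2 * \<epsilon> + b))"
      using ab(1) by (intro mult_left_mono) auto
    moreover have "a * (inverse a * mdist m1 (g p) (g q)) = mdist m1 (g p) (g q)"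
      using ab(1) by simp
    ultimately show "mdist m1 (g p) (g q) \<le> a * mdist m2 p q + b'"
      unfolding b'_def by (simp add: distrib_left)
  qed
  then have "qi_embedding m2 m1 g"
    unfolding qi_embedding_def using g(1) ab(1)
    by (intro conjI exI[of _ a] exI[of _ b'] ballI) (simp_all add: image_subset_iff)
  then show ?thesis
    using that by blast
qed

section \<open>Subspaces, unions and products\<close>

lemma asymp_dim_submetric_mono:
  assumes "S \<noteq> {}" "S \<subseteq> T" "T \<subseteq> mspace m"
  shows "asymp_dim (submetric m S) \<le> asymp_dim (submetric m T)"
proof (rule asymp_dim_mono_qi_embedding)
  show "qi_embedding (submetric m S) (submetric m T) id"
    using assms(2) by (rule qi_embedding_submetric)
  show "mspace (submetric m S) \<noteq> {}"
    using assms by (simp add: Int_absorb2)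
qed

text \<open>The two growth bounds have different base points, so the trace on \<open>T\<close> of a ball of the
  union about \<open>x\<close> is placed inside a ball about \<open>y\<close> whose radius is larger by the distance of the two.\<close>

lemma growth_at_Un:
  assumes g1: "growth_at (submetric m S) x s" and g2: "growth_at (submetric m T) y s"
    and x: "x \<in> S \<inter> mspace m" and y: "y \<in> T \<inter> mspace m"
  shows "growth_at (submetric m (S \<union> T)) x s"
proof -
  obtain D1 C1 where ev1: "eventually (\<lambda>R. small_cover (submetric m S) D1 (C1 * R powr s)
      (mball_of (submetric m S) x R)) at_top"
    using g1 unfolding growth_at_def by blast
  obtain D2 C2 where ev2: "eventually (\<lambda>R. small_cover (submetric m T) D2 (C2 * R powr s)
      (mball_of (submetric m T) y (1 * R + mdist m y x))) at_top"
    using growth_atD_affine[OF g2, of 1 "mdist m y x"] by auto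
  have ambient: "small_cover (submetric m U) D n A \<longleftrightarrow> small_cover (submetric m (S \<union> T)) D n A"
    for U D n A
    unfolding small_cover_def by simp
  have "eventually (\<lambda>R. small_cover (submetric m (S \<union> T)) (max D1 D2) ((C1 + C2) * R powr s)
      (mball_of (submetric m (S \<union> T)) x R)) at_top"
    using ev1 ev2
  proof eventually_elim
    case (elim R)
    have "mdist m y p < R + mdist m y x" if "p \<in> mspace m" "mdist m x p < R" for p
      using mdist_triangle[of y m x p] that x y by auto
    then have "mball_of (submetric m (S \<union> T)) x R \<subseteq>
        mball_of (submetric m S) x R \<union> mball_of (submetric m T) y (1 * R + mdist m y x)"
      using x y by auto
    then show ?case
      using small_cover_Un[OF elim[unfolded ambient[of S] ambient[of T]]]
      by (auto elim!: small_cover_mono simp: distrib_right)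
  qed
  then show ?thesis
    unfolding growth_at_def by blast
qed

lemma asymp_dim_Un:
  assumes "S \<noteq> {}" "T \<noteq> {}" "S \<subseteq> mspace m" "T \<subseteq> mspace m"
  shows "asymp_dim (submetric m (S \<union> T)) = max (asymp_dim (submetric m S)) (asymp_dim (submetric m T))"
proof (rule antisym)
  show "asymp_dim (submetric m (S \<union> T)) \<le> max (asymp_dim (submetric m S)) (asymp_dim (submetric m T))"
  proof (rule ereal_le_if_le_all_greater_reals)
    fix s assume s: "max (asymp_dim (submetric m S)) (asymp_dim (submetric m T)) < ereal s"
    obtain x y where xy: "x \<in> S \<inter> mspace m" "y \<in> T \<inter> mspace m"
      using assms by blast
    have "growth_at (submetric m S) x s" "growth_at (submetric m T) y s"
      using s xy by (auto intro!: growth_if_asymp_dim_less)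
    then have "growth_at (submetric m (S \<union> T)) x s"
      using xy by (rule growth_at_Un)
    then show "asymp_dim (submetric m (S \<union> T)) \<le> ereal s"
      using xy by (auto intro: asymp_dim_le_if_growth)
  qed
  show "max (asymp_dim (submetric m S)) (asymp_dim (submetric m T)) \<le> asymp_dim (submetric m (S \<union> T))"
    using assms by (auto intro!: asymp_dim_submetric_mono)
qed

lemma growth_at_prod:
  assumes g1: "growth_at m1 x s" and g2: "growth_at m2 y t"
  shows "growth_at (prod_metric m1 m2) (x, y) (s + t)"
proof -
  obtain D1 C1 where
    ev1: "eventually (\<lambda>R. small_cover m1 D1 (C1 * R powr s) (mball_of m1 x R)) at_top"
    using g1 unfolding growth_at_def by blast
  obtain D2 C2 where
    ev2: "eventually (\<lambda>R. small_cover m2 D2 (C2 * R powr t) (mball_of m2 y R)) at_top"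
    using g2 unfolding growth_at_def by blast
  have "eventually (\<lambda>R. small_cover (prod_metric m1 m2) (D1 + D2) ((C1 * C2) * R powr (s + t))
      (mball_of (prod_metric m1 m2) (x, y) R)) at_top"
    using ev1 ev2
  proof eventually_elim
    case (elim R)
    have "small_cover (prod_metric m1 m2) (D1 + D2) ((C1 * R powr s) * (C2 * R powr t))
        (mball_of m1 x R \<times> mball_of m2 y R)"
      by (rule small_cover_prod[OF elim]) auto
    moreover have "mball_of (prod_metric m1 m2) (x, y) R \<subseteq> mball_of m1 x R \<times> mball_of m2 y R"
      by (auto simp: prod_dist_def intro: le_less_trans[OF real_sqrt_sum_squares_ge1]
          le_less_trans[OF real_sqrt_sum_squares_ge2])
    ultimately show ?case
      by (auto elim!: small_cover_mono simp: powr_add)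
  qed
  then show ?thesis
    unfolding growth_at_def by blast
qed

text \<open>For extended reals \<open>\<infinity> + (- \<infinity>) = \<infinity>\<close>, so the bound is trivial as soon as one summand is \<open>\<infinity>\<close>.\<close>

lemma ereal_le_add_if_le_all_greater_reals:
  fixes A B c :: ereal
  assumes le: "\<And>s t. \<lbrakk>A < ereal s; B < ereal t\<rbrakk> \<Longrightarrow> c \<le> ereal (s + t)"
  shows "c \<le> A + B"
proof (cases "A = \<infinity> \<or> B = \<infinity>")
  case False
  show ?thesis
  proof (rule ereal_le_if_le_all_greater_reals)
    fix z assume z: "A + B < ereal z"
    obtain s t where "A < ereal s" "B < ereal t" "s + t \<le> z"
    proof (cases A; cases B)
      fix a b assume ab: "A = ereal a" "B = ereal b"
      define e where "e = (z - a - b) / 2"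
      have "e > 0"
        using z ab unfolding e_def by simp
      then show thesis
        using that[of "a + e" "b + e"] ab by (simp add: e_def field_simps)
    next
      fix a assume "A = ereal a" "B = - \<infinity>"
      then show thesis
        using that[of "a + 1" "z - a - 1"] by simp
    next
      fix b assume "A = - \<infinity>" "B = ereal b"
      then show thesis
        using that[of "z - b - 1" "b + 1"] by simp
    next
      assume "A = - \<infinity>" "B = - \<infinity>"
      then show thesis
        using that[of 0 z] by simp
    qed (use False in auto)
    then show "c \<le> ereal z"
      using le by (meson ereal_less_eq(3) order_trans)
  qed
qed auto

lemma asymp_dim_prod:
  assumes "mspace m1 \<noteq> {}" "mspace m2 \<noteq> {}"
  shows "asymp_dim (prod_metric m1 m2) \<le> asymp_dim m1 + asymp_dim m2"
proof (rule ereal_le_add_if_le_all_greater_reals)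
  fix s t assume st: "asymp_dim m1 < ereal s" "asymp_dim m2 < ereal t"
  obtain x y where xy: "x \<in> mspace m1" "y \<in> mspace m2"
    using assms by blast
  have "growth_at (prod_metric m1 m2) (x, y) (s + t)"
    using st xy by (intro growth_at_prod growth_if_asymp_dim_less)
  then show "asymp_dim (prod_metric m1 m2) \<le> ereal (s + t)"
    using xy by (auto intro: asymp_dim_le_if_growth)
qed

theorem theorem1p8:
  shows
    "(\<forall>(Y::'a metric) X.
        X \<noteq> {} \<and> X \<subseteq> mspace Y \<longrightarrow>
          asymp_dim (submetric Y X) \<le> asymp_dim Y) \<and>
     (\<forall>(X::'b metric) X1 X2.
        X1 \<noteq> {} \<and> X2 \<noteq> {} \<and> X1 \<subseteq> mspace X \<and> X2 \<subseteq> mspace X \<longrightarrow>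
          asymp_dim (submetric X (X1 \<union> X2)) =
            max (asymp_dim (submetric X X1)) (asymp_dim (submetric X X2))) \<and>
     (\<forall>(X::'c metric) (Y::'d metric).
        mspace X \<noteq> {} \<and> mspace Y \<noteq> {} \<longrightarrow>
          asymp_dim (prod_metric X Y) \<le> asymp_dim X + asymp_dim Y \<and>
          (\<forall>P. mspace P = mspace X \<times> mspace Y \<and> roughly_isometric (prod_metric X Y) P \<longrightarrow>
             asymp_dim P \<le> asymp_dim X + asymp_dim Y))"
proof (intro conjI allI impI)
  fix Y :: "'a metric" and X
  assume "X \<noteq> {} \<and> X \<subseteq> mspace Y"
  then show "asymp_dim (submetric Y X) \<le> asymp_dim Y"
    using asymp_dim_submetric_mono[of X "mspace Y" Y] by simp
next
  fix X :: "'b metric" and X1 X2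
  assume "X1 \<noteq> {} \<and> X2 \<noteq> {} \<and> X1 \<subseteq> mspace X \<and> X2 \<subseteq> mspace X"
  then show "asymp_dim (submetric X (X1 \<union> X2)) =
      max (asymp_dim (submetric X X1)) (asymp_dim (submetric X X2))"
    by (intro asymp_dim_Un) auto
next
  fix X :: "'c metric" and Y :: "'d metric"
  assume "mspace X \<noteq> {} \<and> mspace Y \<noteq> {}"
  then show "asymp_dim (prod_metric X Y) \<le> asymp_dim X + asymp_dim Y"
    by (intro asymp_dim_prod) auto
next
  fix X :: "'c metric" and Y :: "'d metric" and P :: "('c \<times> 'd) metric"
  assume ne: "mspace X \<noteq> {} \<and> mspace Y \<noteq> {}"
    and P: "mspace P = mspace X \<times> mspace Y \<and> roughly_isometric (prod_metric X Y) P"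
  then obtain g where "qi_embedding P (prod_metric X Y) g"
    unfolding roughly_isometric_def using rough_isometry_quasi_inverse by blast
  then have "asymp_dim P \<le> asymp_dim (prod_metric X Y)"
    using ne P by (intro asymp_dim_mono_qi_embedding) auto
  also have "\<dots> \<le> asymp_dim X + asymp_dim Y"
    using ne by (intro asymp_dim_prod) auto
  finally show "asymp_dim P \<le> asymp_dim X + asymp_dim Y" .
qed

end
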